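(* If $G$ is a finite simple graph with at least one edge, then $G$ has an optimal fractional PSD forcing set $(\mathcal{D},\mathcal{L})$ together with a forcing process starting from it whose first force is performed by a light blue vertex (a vertex of $\mathcal{L}$).
   Context: Three-color fractional PSD forcing game on $G$: each vertex is initially colored dark blue, light blue, or white; $\mathcal{D}$ is the set of dark blue and $\mathcal{L}$ the set of light blue vertices. At each step, with $\mathcal{D}_t,\mathcal{L}_t$ the current dark/light blue sets and $W_1,\dots,W_h$ the vertex sets of the connected components of $G-\mathcal{D}_t$: if $u\in\mathcal{D}_t\cup(\mathcal{L}_t\cap W_i)$ and $w\in W_i$ is the only neighbor of $u$ in $G[\mathcal{D}_t\cup W_i]$ that is light blue or white, then $u$ may force $w$, i.e. $w$ becomes dark blue. $(\mathcal{D},\mathcal{L})$ is a fractional PSD forcing set if repeated application can make all vertices dark blue. $\hat Z_f^+(G)$ is the minimum of $|\mathcal{D}|$ over fractional PSD forcing sets. A fractional PSD forcing set $(\mathcal{D},\mathcal{L})$ is optimal if $|\mathcal{D}|=\hat Z_f^+(G)$ and no fractional PSD forcing set with $\hat Z_f^+(G)$ dark blue vertices has fewer than $|\mathcal{L}|$ light blue vertices. *)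

theory Defs
  imports Graph_Theory.Graph_Theory
begin

text \<open>
  A finite simple graph is a \<^locale>\<open>graph\<close> of the library: a finite symmetric digraph without
  loops and without parallel arcs, each undirected edge being a pair of opposite arcs.
  A three-colouring of the vertices is given by the set \<open>D\<close> of dark blue and the set \<open>L\<close> of light
  blue vertices; the vertices in neither set are white.
\<close>

definition three_coloring :: "('a, 'b) pre_digraph \<Rightarrow> 'a set \<Rightarrow> 'a set \<Rightarrow> bool" where
  "three_coloring G D L \<longleftrightarrow> D \<subseteq> verts G \<and> L \<subseteq> verts G \<and> D \<inter> L = {}"

text \<open>
  The graph \<open>G\<close> is symmetric, so the strongly connected components of \<open>G - D\<close> are its
  connected components.
\<close>

definition nondark_components :: "('a, 'b) pre_digraph \<Rightarrow> 'a set \<Rightarrow> 'a set set" where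
  "nondark_components G D = pre_digraph.sccs_verts (G \<restriction> (verts G - D))"

definition can_force :: "('a, 'b) pre_digraph \<Rightarrow> 'a set \<Rightarrow> 'a set \<Rightarrow> 'a \<Rightarrow> 'a \<Rightarrow> bool" where
  "can_force G D L u w \<longleftrightarrow>
     (\<exists>W \<in> nondark_components G D. w \<in> W \<and> u \<in> D \<union> (L \<inter> W) \<and>
        {x. u \<rightarrow>\<^bsub>G \<restriction> (D \<union> W)\<^esub> x \<and> x \<notin> D} = {w})"

text \<open>
  \<open>forcing_process G D L fs\<close>: the forces in \<open>fs\<close>, listed as pairs (forcing vertex, forced vertex),
  can be carried out one after the other from \<open>(D, L)\<close> and turn all vertices dark blue.
\<close>

primrec forcing_process ::
    "('a, 'b) pre_digraph \<Rightarrow> 'a set \<Rightarrow> 'a set \<Rightarrow> ('a \<times> 'a) list \<Rightarrow> bool" where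
  "forcing_process G D L [] \<longleftrightarrow> D = verts G"
| "forcing_process G D L (f # fs) \<longleftrightarrow>
     can_force G D L (fst f) (snd f) \<and> forcing_process G (insert (snd f) D) (L - {snd f}) fs"

definition fractional_psd_forcing_set ::
    "('a, 'b) pre_digraph \<Rightarrow> 'a set \<Rightarrow> 'a set \<Rightarrow> bool" where
  "fractional_psd_forcing_set G D L \<longleftrightarrow>
     three_coloring G D L \<and> (\<exists>fs. forcing_process G D L fs)"

definition fractional_psd_forcing_number :: "('a, 'b) pre_digraph \<Rightarrow> nat" where
  "fractional_psd_forcing_number G =
     (LEAST k. \<exists>D L. fractional_psd_forcing_set G D L \<and> card D = k)"

text \<open>The minimum is over a nonempty set, so it is attained.\<close>

lemma fractional_psd_forcing_set_verts: "fractional_psd_forcing_set G (verts G) {}"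
  unfolding fractional_psd_forcing_set_def three_coloring_def
  by (auto intro: exI[of _ "[]"])

lemma fractional_psd_forcing_number_attained:
  "\<exists>D L. fractional_psd_forcing_set G D L \<and> card D = fractional_psd_forcing_number G"
  unfolding fractional_psd_forcing_number_def
  by (rule LeastI) (use fractional_psd_forcing_set_verts in blast)

definition optimal_fractional_psd_forcing_set ::
    "('a, 'b) pre_digraph \<Rightarrow> 'a set \<Rightarrow> 'a set \<Rightarrow> bool" where
  "optimal_fractional_psd_forcing_set G D L \<longleftrightarrow>
     fractional_psd_forcing_set G D L \<and>
     card D = fractional_psd_forcing_number G \<and>
     (\<forall>D' L'. fractional_psd_forcing_set G D' L' \<and> card D' = fractional_psd_forcing_number G
        \<longrightarrow> card L \<le> card L')"

end

theory Submission
  imports Defs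
begin

text \<open>
  Starting from an optimal set, look at the first force performed by a light blue vertex \<open>v\<close>; let
  \<open>E\<close> be the dark blue set just before it. Only forces by dark blue vertices precede it, and
  each such force \<open>u \<rightarrow> w\<close> in the component of \<open>v\<close> can be undone by exchange: colour \<open>w\<close> dark blue
  instead of \<open>u\<close>. The result is still a forcing set, since \<open>w\<close> forces \<open>u\<close> in the component
  of \<open>u\<close>, and the component of \<open>v\<close> loses \<open>w\<close> and gains nothing. After these exchanges all
  neighbours of \<open>v\<close> in \<open>E\<close> are dark blue from the start, so \<open>v\<close> can perform the first force.
  If no force is performed by a light blue vertex, then apply the same exchanges to the last
  vertex \<open>v\<close> to be forced: they lead to a minimum set in which all neighbours of \<open>v\<close> are dark
  blue. That is impossible, because one neighbour could be dropped and forced by a light blue \<open>v\<close>.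
  The edge rules out that all vertices are dark blue initially.
\<close>

section \<open>Unions of components of the nondark graph\<close>

text \<open>For symmetric \<open>G\<close>, these are the unions of components of
  \<open>G - D\<close>, the empty union included.\<close>

definition closed_off :: "('a, 'b) pre_digraph \<Rightarrow> 'a set \<Rightarrow> 'a set \<Rightarrow> bool" where
  "closed_off G D X \<longleftrightarrow>
     X \<subseteq> verts G - D \<and> (\<forall>x\<in>X. \<forall>y. x \<rightarrow>\<^bsub>G\<^esub> y \<longrightarrow> y \<in> X \<union> D)"

lemma dominates_induce_subgraph_iff:
  "u \<rightarrow>\<^bsub>G \<restriction> S\<^esub> v \<longleftrightarrow> u \<rightarrow>\<^bsub>G\<^esub> v \<and> u \<in> S \<and> v \<in> S"
  by (force simp: arcs_ends_def arc_to_ends_def)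

lemma (in graph) dominates_sym: "u \<rightarrow>\<^bsub>G\<^esub> v \<Longrightarrow> v \<rightarrow>\<^bsub>G\<^esub> u"
  using sym_arcs by (auto simp: symmetric_def dest: symD)

lemma (in graph) dominates_neq: "u \<rightarrow>\<^bsub>G\<^esub> v \<Longrightarrow> u \<noteq> v"
  using adj_not_same by blast

lemma (in graph) sym_digraph_induce:
  assumes "S \<subseteq> verts G"
  shows "sym_digraph (G \<restriction> S)"
proof -
  have "wf_digraph (G \<restriction> S)" by blast
  moreover have "symmetric (G \<restriction> S)"
    unfolding symmetric_def
    by (rule symI) (metis dominates_induce_subgraph_iff dominates_sym)
  ultimately show ?thesis
    by (simp add: sym_digraph_def sym_digraph_axioms_def)
qed

lemma (in graph) nondark_component_closed_off:
  assumes "W \<in> nondark_components G D"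
  shows "closed_off G D W"
proof -
  let ?H = "G \<restriction> (verts G - D)"
  interpret H: sym_digraph ?H by (rule sym_digraph_induce) auto
  from assms have W: "W \<in> H.sccs_verts" by (simp add: nondark_components_def)
  then have sub: "W \<subseteq> verts G - D" using H.sccs_verts_subsets by fastforce
  moreover have "y \<in> W \<union> D" if "x \<in> W" "x \<rightarrow>\<^bsub>G\<^esub> y" for x y
  proof (rule ccontr)
    assume y: "y \<notin> W \<union> D"
    with that sub have "x \<rightarrow>\<^bsub>?H\<^esub> y"
      using adj_in_verts(2)[OF that(2)] by (auto simp: dominates_induce_subgraph_iff)
    then have "x \<rightarrow>\<^sup>*\<^bsub>?H\<^esub> y" "y \<rightarrow>\<^sup>*\<^bsub>?H\<^esub> x"
      using H.symmetric_reachable' by blast+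
    with W y that(1) show False by (auto simp: H.in_sccs_verts_conv_reachable)
  qed
  ultimately show ?thesis by (auto simp: closed_off_def)
qed

text \<open>A path in \<open>G - D\<close> that starts in \<open>X\<close> cannot leave
  \<open>X\<close>, so the component of \<open>w\<close> works.\<close>

lemma (in graph) nondark_component_within:
  assumes X: "closed_off G D X" and w: "w \<in> X"
  obtains W where "W \<in> nondark_components G D" "w \<in> W" "W \<subseteq> X"
proof -
  let ?H = "G \<restriction> (verts G - D)"
  interpret H: sym_digraph ?H by (rule sym_digraph_induce) auto
  from X w have wH: "w \<in> verts ?H" by (auto simp: closed_off_def)
  have "y \<in> X" if "w \<rightarrow>\<^sup>*\<^bsub>?H\<^esub> y" for y
    using that
  proof (induction rule: H.reachable_induct)
    case base
    show ?case using w .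
  next
    case (step x y)
    then show ?case using X by (auto simp: closed_off_def dominates_induce_subgraph_iff)
  qed
  then have "H.scc_of w \<subseteq> X" by (auto simp: H.scc_of_def)
  moreover have "H.scc_of w \<in> nondark_components G D"
    using H.scc_of_in_sccs_verts[OF wH] by (simp add: nondark_components_def)
  moreover have "w \<in> H.scc_of w" using wH by (auto simp: H.scc_of_def)
  ultimately show thesis using that by blast
qed

text \<open>
  Unlike components, the sets \<open>X\<close> here survive the removal of vertices that become dark blue.
\<close>

lemma (in graph) can_force_iff:
  "can_force G D L u w \<longleftrightarrow>
     (\<exists>X. closed_off G D X \<and> u \<in> D \<union> (L \<inter> X) \<and> {x \<in> X. u \<rightarrow>\<^bsub>G\<^esub> x} = {w})"
proof
  assume "can_force G D L u w"
  then obtain W where W: "W \<in> nondark_components G D" "u \<in> D \<union> (L \<inter> W)"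
    and eq: "{x. u \<rightarrow>\<^bsub>G \<restriction> (D \<union> W)\<^esub> x \<and> x \<notin> D} = {w}"
    by (auto simp: can_force_def)
  have co: "closed_off G D W" using W(1) by (rule nondark_component_closed_off)
  then have "{x \<in> W. u \<rightarrow>\<^bsub>G\<^esub> x} = {x. u \<rightarrow>\<^bsub>G \<restriction> (D \<union> W)\<^esub> x \<and> x \<notin> D}"
    using W(2) by (auto simp: dominates_induce_subgraph_iff closed_off_def)
  with co W(2) eq
  show "\<exists>X. closed_off G D X \<and> u \<in> D \<union> (L \<inter> X) \<and> {x \<in> X. u \<rightarrow>\<^bsub>G\<^esub> x} = {w}" by auto
next
  assume "\<exists>X. closed_off G D X \<and> u \<in> D \<union> (L \<inter> X) \<and> {x \<in> X. u \<rightarrow>\<^bsub>G\<^esub> x} = {w}"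
  then obtain X where X: "closed_off G D X" "u \<in> D \<union> (L \<inter> X)"
    and eq: "{x \<in> X. u \<rightarrow>\<^bsub>G\<^esub> x} = {w}" by auto
  from eq have wX: "w \<in> X" and uw: "u \<rightarrow>\<^bsub>G\<^esub> w" by blast+
  from X(1) wX obtain W where W: "W \<in> nondark_components G D" "w \<in> W" "W \<subseteq> X"
    by (rule nondark_component_within)
  have co: "closed_off G D W" using W(1) by (rule nondark_component_closed_off)
  \<comment> \<open>A light \<open>u\<close> lies in \<open>X\<close>, hence is not dark, and as a
    neighbour of \<open>w\<close> it belongs to the component \<open>W\<close>.\<close>
  have u: "u \<in> D \<union> (L \<inter> W)"
    using X(2) co W(2) dominates_sym[OF uw] by (auto simp: closed_off_def)
  have "{x. u \<rightarrow>\<^bsub>G \<restriction> (D \<union> W)\<^esub> x \<and> x \<notin> D} = {x \<in> W. u \<rightarrow>\<^bsub>G\<^esub> x}"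
    using u co by (auto simp: dominates_induce_subgraph_iff closed_off_def)
  also have "\<dots> = {w}" using eq W(2,3) by auto
  finally show "can_force G D L u w" using W u by (auto simp: can_force_def)
qed

section \<open>Light forces and monotonicity\<close>

lemma (in graph) light_can_force:
  assumes "u \<in> L" "u \<in> verts G - D" "{x. u \<rightarrow>\<^bsub>G\<^esub> x} - D = {w}"
  shows "can_force G D L u w"
proof -
  have "closed_off G D (verts G - D)" by (auto simp: closed_off_def adj_in_verts)
  moreover have "{x \<in> verts G - D. u \<rightarrow>\<^bsub>G\<^esub> x} = {w}"
    using assms(3) adj_in_verts(2)[of u] by blast
  ultimately show ?thesis using assms(1,2) unfolding can_force_iff by blast
qed

text \<open>The forces are replayed from the larger dark set, skipping those whose target is already
  dark; the witness \<open>X\<close> shrinks to \<open>X - D'\<close>.\<close>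

lemma (in graph) forcing_process_mono:
  assumes "forcing_process G D L fs" "D \<subseteq> D'" "D' \<subseteq> verts G" "L \<subseteq> D' \<union> L'"
  shows "\<exists>fs'. forcing_process G D' L' fs'"
  using assms
proof (induction fs arbitrary: D L D' L')
  case Nil
  then have "forcing_process G D' L' []" by auto
  then show ?case by blast
next
  case (Cons f fs)
  obtain u w where f: "f = (u, w)" by (cases f)
  with Cons.prems have step: "can_force G D L u w"
    and rest: "forcing_process G (insert w D) (L - {w}) fs" by auto
  show ?case
  proof (cases "w \<in> D'")
    case True
    show ?thesis by (rule Cons.IH[OF rest]) (use True Cons.prems in auto)
  next
    case False
    from step obtain X where X: "closed_off G D X" "u \<in> D \<union> (L \<inter> X)"
      and eq: "{x \<in> X. u \<rightarrow>\<^bsub>G\<^esub> x} = {w}" by (auto simp: can_force_iff)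
    from eq have wX: "w \<in> X" by blast
    have "closed_off G D' (X - D')"
      using X(1) Cons.prems(2) by (auto simp: closed_off_def)
    moreover have "u \<in> D' \<union> (L' \<inter> (X - D'))" using X(2) Cons.prems(2,4) by auto
    moreover have "{x \<in> X - D'. u \<rightarrow>\<^bsub>G\<^esub> x} = {w}" using eq False by auto
    ultimately have "can_force G D' L' u w" unfolding can_force_iff by blast
    moreover have "w \<in> verts G" using wX X(1) by (auto simp: closed_off_def)
    then have "\<exists>fs'. forcing_process G (insert w D') (L' - {w}) fs'"
      by (intro Cons.IH[OF rest]) (use Cons.prems in auto)
    then obtain fs' where "forcing_process G (insert w D') (L' - {w}) fs'" ..
    ultimately have "forcing_process G D' L' ((u, w) # fs')" by simp
    then show ?thesis by blast
  qed
qed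

section \<open>The exchange argument\<close>

text \<open>
  The dark blue set of an intermediate stage is \<open>E\<close>; the component of \<open>v\<close> in \<open>G - D\<close> avoids it,
  so every neighbour of \<open>v\<close> in \<open>E\<close> belongs to \<open>D\<close>.
\<close>

definition rerooted :: "('a, 'b) pre_digraph \<Rightarrow> 'a set \<Rightarrow> nat \<Rightarrow> 'a \<Rightarrow> 'a set \<Rightarrow> 'a set \<Rightarrow> bool" where
  "rerooted G L n v E D \<longleftrightarrow>
     D \<subseteq> verts G \<and> card D = n \<and> (\<exists>fs. forcing_process G D (L - D) fs) \<and>
     (\<exists>C. v \<in> C \<and> closed_off G D C \<and> C \<inter> E = {})"

text \<open>Carries the invariant across one force by a dark vertex: either \<open>D\<close> stays
  and at most \<open>C\<close> shrinks, or \<open>w\<close> takes the place of \<open>u\<close> in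
  \<open>D\<close>.\<close>

lemma (in graph) reroot:
  assumes D: "rerooted G L n v E D"
    and X: "closed_off G E X" and u: "u \<in> E" and eq: "{x \<in> X. u \<rightarrow>\<^bsub>G\<^esub> x} = {w}"
    and v: "v \<noteq> w"
  shows "\<exists>D'. rerooted G L n v (insert w E) D'"
proof -
  from D obtain C fs where D1: "D \<subseteq> verts G" "card D = n" "forcing_process G D (L - D) fs"
    and C: "v \<in> C" "closed_off G D C" "C \<inter> E = {}"
    by (auto simp: rerooted_def)
  from eq have wX: "w \<in> X" and uw: "u \<rightarrow>\<^bsub>G\<^esub> w" by blast+
  have wu: "w \<rightarrow>\<^bsub>G\<^esub> u" using uw by (rule dominates_sym)
  have wE: "w \<notin> E" using X wX by (auto simp: closed_off_def)
  \<comment> \<open>\<open>C\<close> avoids \<open>E\<close> and \<open>X\<close> is closed off in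
    \<open>G - E\<close>, so an edge inside \<open>C\<close> cannot leave \<open>X\<close>.\<close>
  have cross: "y \<in> X \<longleftrightarrow> x \<in> X" if "x \<rightarrow>\<^bsub>G\<^esub> y" "x \<in> C" "y \<in> C" for x y
    using that X C(3) dominates_sym[OF that(1)] by (auto simp: closed_off_def)
  consider (out) "w \<notin> C" | (other) "w \<in> C" "v \<notin> X" | (same) "w \<in> C" "v \<in> X" by blast
  then show ?thesis
  proof cases
    case out
    then have "rerooted G L n v (insert w E) D"
      using D1 C by (auto simp: rerooted_def)
    then show ?thesis by blast
  next
    case other
    \<comment> \<open>Discarding \<open>X\<close> from \<open>C\<close> removes \<open>w\<close> and
      keeps \<open>v\<close>.\<close>
    have "closed_off G D (C - X)"
      using C(2) cross unfolding closed_off_def by blast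
    then have "rerooted G L n v (insert w E) D"
      using D1 C wX other unfolding rerooted_def
      by (intro conjI exI[of _ fs] exI[of _ "C - X"]) auto
    then show ?thesis by blast
  next
    case same
    let ?D' = "insert w (D - {u})"
    have wD: "w \<notin> D" "w \<in> verts G" using C(2) same by (auto simp: closed_off_def)
    \<comment> \<open>Being in \<open>E\<close>, \<open>u\<close> is outside \<open>C\<close>; as a
      neighbour of \<open>w \<in> C\<close> it must then be in \<open>D\<close>.\<close>
    have uD: "u \<in> D"
      using C u wu same by (auto simp: closed_off_def)
    have fin: "finite D" using D1(1) finite_verts finite_subset by blast
    have D': "?D' \<subseteq> verts G" "card ?D' = n"
      using D1 wD uD fin card_Suc_Diff1[OF fin uD] by auto
    have unw: "u \<noteq> w" using uD wD by auto
    let ?C' = "(C \<inter> X) - {w}"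
    \<comment> \<open>\<open>w\<close> is the only neighbour of \<open>u\<close> in
      \<open>X\<close>, so taking \<open>u\<close> out of the dark set opens no way out of
      \<open>?C'\<close>.\<close>
    have no: "\<not> x \<rightarrow>\<^bsub>G\<^esub> u" if "x \<in> ?C'" for x
      using that eq dominates_sym by blast
    have C': "closed_off G ?D' ?C'"
      using C(2) cross no unfolding closed_off_def by blast
    \<comment> \<open>The component of \<open>u\<close> avoids \<open>?C'\<close>, so \<open>u\<close> is the only nondark neighbour of \<open>w\<close> in it.\<close>
    have "closed_off G ?D' (verts G - ?D' - ?C')"
      using C' dominates_sym adj_in_verts unfolding closed_off_def by blast
    moreover have "{x \<in> verts G - ?D' - ?C'. w \<rightarrow>\<^bsub>G\<^esub> x} = {u}"
    proof -
      have "x = u" if "x \<in> verts G - ?D' - ?C'" "w \<rightarrow>\<^bsub>G\<^esub> x" for x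
      proof (rule ccontr)
        assume "x \<noteq> u"
        with that have "x \<notin> D" "x \<noteq> w" by auto
        with that C(2) same have "x \<in> C" unfolding closed_off_def by blast
        with cross[OF that(2)] same wX have "x \<in> X" by blast
        with \<open>x \<in> C\<close> \<open>x \<noteq> w\<close> that show False by blast
      qed
      moreover have "u \<in> verts G - ?D' - ?C'"
        using uD D1(1) unw C(2) by (auto simp: closed_off_def)
      ultimately show ?thesis using wu by blast
    qed
    ultimately have step: "can_force G ?D' (L - ?D') w u"
      unfolding can_force_iff by blast
    \<comment> \<open>Once \<open>u\<close> is forced, the dark set is \<open>D\<close> together
      with \<open>w\<close>, so the old process can be replayed.\<close>
    have "\<exists>fs'. forcing_process G (insert u ?D') (L - ?D' - {u}) fs'"
      by (rule forcing_process_mono[OF D1(3)]) (use D' uD D1(1) in auto)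
    then obtain fs' where "forcing_process G (insert u ?D') (L - ?D' - {u}) fs'" ..
    with step have "forcing_process G ?D' (L - ?D') ((w, u) # fs')" by simp
    moreover have "v \<in> ?C'" "?C' \<inter> insert w E = {}" using C same v by auto
    ultimately have "rerooted G L n v (insert w E) ?D'"
      unfolding rerooted_def
      by (intro conjI exI[of _ ?C']) (use D' C' in \<open>assumption | blast\<close>)+
    then show ?thesis by blast
  qed
qed

text \<open>Induction along the process up to the first light force or the last force. The invariant
  is kept for all nondark \<open>v\<close> at once, since the vertex finally chosen is not known
  earlier. \<open>M\<close> is the current light set, \<open>L\<close> the initial one.\<close>

lemma (in graph) light_start_or_saturated:
  assumes "forcing_process G E M fs" "M \<subseteq> L" "E \<noteq> verts G" "E \<subseteq> verts G"
    and "\<forall>v \<in> verts G - E. \<exists>D. rerooted G L n v E D"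
  shows "\<exists>v D fs'. v \<in> verts G - D \<and> D \<subseteq> verts G \<and> card D = n \<and>
           forcing_process G D (L - D) fs' \<and> (\<exists>y. v \<rightarrow>\<^bsub>G\<^esub> y) \<and>
           ({x. v \<rightarrow>\<^bsub>G\<^esub> x} \<subseteq> D \<or> v \<in> L \<and> (\<exists>w. {x. v \<rightarrow>\<^bsub>G\<^esub> x} - D = {w}))"
  using assms
proof (induction fs arbitrary: E M)
  case Nil
  then show ?case by simp
next
  case (Cons f fs)
  obtain u w where f: "f = (u, w)" by (cases f)
  with Cons.prems have step: "can_force G E M u w"
    and rest: "forcing_process G (insert w E) (M - {w}) fs" by auto
  from step obtain X where X: "closed_off G E X" "u \<in> E \<union> (M \<inter> X)"
    and eq: "{x \<in> X. u \<rightarrow>\<^bsub>G\<^esub> x} = {w}" by (auto simp: can_force_iff)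
  from eq have wX: "w \<in> X" and uw: "u \<rightarrow>\<^bsub>G\<^esub> w" by blast+
  have w: "w \<in> verts G - E" using X(1) wX by (auto simp: closed_off_def)
  consider (light) "u \<in> M" "u \<in> X" | (last) "u \<in> E" "insert w E = verts G"
    | (dark) "u \<in> E" "insert w E \<noteq> verts G" using X(2) by blast
  then show ?case
  proof cases
    case light
    then have "u \<in> verts G - E" using X(1) by (auto simp: closed_off_def)
    with Cons.prems(5) obtain D where D: "rerooted G L n u E D" by blast
    then obtain C fs' where C: "u \<in> C" "closed_off G D C" "C \<inter> E = {}"
      and fs': "forcing_process G D (L - D) fs'" by (auto simp: rerooted_def)
    \<comment> \<open>A neighbour of \<open>u\<close> outside \<open>D\<close> lies in
      \<open>C\<close>, hence outside \<open>E\<close>, hence in \<open>X\<close>, where only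
      \<open>w\<close> is available.\<close>
    have "{x. u \<rightarrow>\<^bsub>G\<^esub> x} - D \<subseteq> {x \<in> X. u \<rightarrow>\<^bsub>G\<^esub> x}"
      using C X(1) light unfolding closed_off_def by blast
    then have "{x. u \<rightarrow>\<^bsub>G\<^esub> x} - D \<subseteq> {w}" using eq by simp
    then have "{x. u \<rightarrow>\<^bsub>G\<^esub> x} \<subseteq> D \<or> {x. u \<rightarrow>\<^bsub>G\<^esub> x} - D = {w}" by blast
    moreover have "u \<in> verts G - D" "D \<subseteq> verts G" "card D = n" "u \<in> L"
      using C D light Cons.prems(2) by (auto simp: rerooted_def closed_off_def)
    ultimately show ?thesis using uw fs' by blast
  next
    case last
    with Cons.prems(5) w obtain D where D: "rerooted G L n w E D" by blast
    then obtain C fs' where C: "w \<in> C" "closed_off G D C" "C \<inter> E = {}"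
      and fs': "forcing_process G D (L - D) fs'" by (auto simp: rerooted_def)
    \<comment> \<open>\<open>C\<close> avoids \<open>E\<close>, and \<open>w\<close> is the only
      vertex outside \<open>E\<close>.\<close>
    have "C = {w}" using C last unfolding closed_off_def by blast
    then have "{x. w \<rightarrow>\<^bsub>G\<^esub> x} \<subseteq> D"
      using C(2) dominates_neq unfolding closed_off_def by blast
    moreover have "w \<in> verts G - D" "D \<subseteq> verts G" "card D = n"
      using C D by (auto simp: rerooted_def closed_off_def)
    ultimately show ?thesis using dominates_sym[OF uw] fs' by blast
  next
    case dark
    have "\<exists>D. rerooted G L n v (insert w E) D" if "v \<in> verts G - insert w E" for v
      using Cons.prems(5) that reroot[OF _ X(1) dark(1) eq] by blast
    then show ?thesis
      by (intro Cons.IH[OF rest]) (use Cons.prems w dark in auto)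
  qed
qed

text \<open>The light \<open>v\<close> first forces \<open>y\<close>, its only nondark neighbour;
  this restores \<open>D\<close>, and the given process can be replayed.\<close>

lemma (in graph) saturated_not_minimum:
  assumes D: "D \<subseteq> verts G" "forcing_process G D L fs"
    and v: "v \<in> verts G - D" "v \<rightarrow>\<^bsub>G\<^esub> y" "{x. v \<rightarrow>\<^bsub>G\<^esub> x} \<subseteq> D" and L: "L \<subseteq> verts G - D"
  shows "fractional_psd_forcing_set G (D - {y}) (insert v L)"
proof -
  have y: "y \<in> D" using v by auto
  have "can_force G (D - {y}) (insert v L) v y"
    by (rule light_can_force) (use v in auto)
  moreover have "\<exists>fs'. forcing_process G (insert y (D - {y})) (insert v L - {y}) fs'"
    by (rule forcing_process_mono[OF D(2)]) (use D(1) y in auto)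
  then obtain fs' where "forcing_process G (insert y (D - {y})) (insert v L - {y}) fs'" ..
  ultimately have "forcing_process G (D - {y}) (insert v L) ((v, y) # fs')" by simp
  moreover have "three_coloring G (D - {y}) (insert v L)"
    using D(1) L v(1) by (auto simp: three_coloring_def)
  ultimately show ?thesis unfolding fractional_psd_forcing_set_def by blast
qed

section \<open>Minimum and optimal forcing sets\<close>

lemma fractional_psd_forcing_number_le:
  "fractional_psd_forcing_set G D L \<Longrightarrow> fractional_psd_forcing_number G \<le> card D"
  unfolding fractional_psd_forcing_number_def by (rule Least_le) blast

lemma optimal_fractional_psd_forcing_set_exists:
  "\<exists>D L. optimal_fractional_psd_forcing_set G D L"
proof -
  let ?P = "\<lambda>(D, L). fractional_psd_forcing_set G D L \<and> card D = fractional_psd_forcing_number G"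
  have "\<exists>p. ?P p" using fractional_psd_forcing_number_attained[of G] by auto
  then obtain p where "?P p" "\<forall>q. ?P q \<longrightarrow> card (snd p) \<le> card (snd q)"
    using ex_has_least_nat[of ?P _ "\<lambda>p. card (snd p)"] by blast
  then show ?thesis
    unfolding optimal_fractional_psd_forcing_set_def by (cases p) auto
qed

theorem theorem2p28:
  fixes G :: "('a, 'b) pre_digraph"
  assumes "graph G"
    and "arcs G \<noteq> {}"
  shows "\<exists>D L u w fs. optimal_fractional_psd_forcing_set G D L \<and>
           forcing_process G D L ((u, w) # fs) \<and> u \<in> L"
proof -
  interpret graph G by fact
  let ?n = "fractional_psd_forcing_number G"
  obtain D L where opt: "optimal_fractional_psd_forcing_set G D L"
    using optimal_fractional_psd_forcing_set_exists by blast
  then obtain fs where fs: "forcing_process G D L fs"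
    and col: "D \<subseteq> verts G" "L \<subseteq> verts G" "D \<inter> L = {}" and n: "card D = ?n"
    by (auto simp: optimal_fractional_psd_forcing_set_def fractional_psd_forcing_set_def
        three_coloring_def)
  have finL: "finite L" using col(2) finite_verts finite_subset by blast
  have smaller: "\<not> fractional_psd_forcing_set G (D' - {y}) L'"
    if "D' \<subseteq> verts G" "card D' = ?n" "y \<in> D'" for D' y L'
  proof
    assume "fractional_psd_forcing_set G (D' - {y}) L'"
    then have "?n \<le> card (D' - {y})" by (rule fractional_psd_forcing_number_le)
    moreover have "card (D' - {y}) < card D'"
      using that finite_verts finite_subset by (metis card_Diff1_less)
    ultimately show False using that by simp
  qed
  \<comment> \<open>For an edge from \<open>x\<close> to \<open>y\<close>, \<open>y\<close> can
    start white, as \<open>x\<close> forces it at once; so the all-dark colouring is not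
    minimum.\<close>
  have "D \<noteq> verts G"
  proof
    assume D: "D = verts G"
    from assms(2) obtain x y where xy: "x \<rightarrow>\<^bsub>G\<^esub> y" by (auto simp: arcs_ends_def arc_to_ends_def)
    have "can_force G (verts G - {y}) {} x y"
      unfolding can_force_iff
      by (rule exI[of _ "{y}"])
        (use xy adj_in_verts[OF xy] dominates_neq[OF xy] in \<open>auto simp: closed_off_def adj_in_verts\<close>)
    then have "forcing_process G (verts G - {y}) {} [(x, y)]"
      using adj_in_verts[OF xy] by auto
    then have "fractional_psd_forcing_set G (verts G - {y}) {}"
      unfolding fractional_psd_forcing_set_def three_coloring_def by blast
    then show False using smaller[of D y "{}"] D n adj_in_verts[OF xy] by auto
  qed
  \<comment> \<open>The invariant holds at the start with \<open>C = verts G - D\<close>.\<close>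
  moreover have "rerooted G L ?n v D D" if "v \<in> verts G - D" for v
  proof -
    have "closed_off G D (verts G - D)" by (auto simp: closed_off_def adj_in_verts)
    moreover have "L - D = L" using col by auto
    ultimately show ?thesis using that fs col n unfolding rerooted_def
      by (metis Diff_disjoint Int_commute)
  qed
  ultimately obtain v D' fs' where D': "v \<in> verts G - D'" "D' \<subseteq> verts G" "card D' = ?n"
      "forcing_process G D' (L - D') fs'" and nb: "\<exists>y. v \<rightarrow>\<^bsub>G\<^esub> y"
    and alt: "{x. v \<rightarrow>\<^bsub>G\<^esub> x} \<subseteq> D' \<or> v \<in> L \<and> (\<exists>w. {x. v \<rightarrow>\<^bsub>G\<^esub> x} - D' = {w})"
    using light_start_or_saturated[OF fs subset_refl _ col(1), of ?n] by blast
  have L': "L - D' \<subseteq> verts G - D'" using col by auto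
  have "\<not> {x. v \<rightarrow>\<^bsub>G\<^esub> x} \<subseteq> D'"
  proof
    assume sat: "{x. v \<rightarrow>\<^bsub>G\<^esub> x} \<subseteq> D'"
    from nb obtain y where y: "v \<rightarrow>\<^bsub>G\<^esub> y" ..
    with sat have "y \<in> D'" by auto
    with smaller D' saturated_not_minimum[OF D'(2,4,1) y sat L'] show False by blast
  qed
  with alt obtain w where vL: "v \<in> L" and w: "{x. v \<rightarrow>\<^bsub>G\<^esub> x} - D' = {w}" by blast
  have "can_force G D' (L - D') v w"
    by (rule light_can_force) (use vL D' w in auto)
  moreover have "w \<in> verts G" using w adj_in_verts(2)[of v w] by blast
  then have "\<exists>gs. forcing_process G (insert w D') (L - D' - {w}) gs"
    by (intro forcing_process_mono[OF D'(4)]) (use D' in auto)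
  then obtain gs where "forcing_process G (insert w D') (L - D' - {w}) gs" ..
  ultimately have "forcing_process G D' (L - D') ((v, w) # gs)" by simp
  moreover have "v \<in> L - D'" using vL D' by auto
  moreover have "fractional_psd_forcing_set G D' (L - D')"
    using D' L' unfolding fractional_psd_forcing_set_def three_coloring_def by blast
  \<comment> \<open>\<open>D'\<close> has minimum size and \<open>L - D'\<close> is no larger than
    \<open>L\<close>, so optimality passes over from \<open>D\<close> and \<open>L\<close>.\<close>
  then have "optimal_fractional_psd_forcing_set G D' (L - D')"
    using opt D'(3) card_mono[OF finL Diff_subset[of L D']] le_trans
    unfolding optimal_fractional_psd_forcing_set_def by blast
  ultimately show ?thesis by blast
qed

end
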